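(* For every non-negative integer $n$ and each $t\in\{42,66\}$, $$\overline{b}(72n+t)\equiv 0 \pmod{256},$$ where $\overline{b}(n)$ denotes the number of overcubic partition pairs of $n$, i.e. the coefficients defined by $\sum_{n=0}^{\infty}\overline{b}(n)q^n=\dfrac{(-q;q)_\infty^2\,(-q^2;q^2)_\infty^2}{(q;q)_\infty^2\,(q^2;q^2)_\infty^2}$.
   Context: For $|q|<1$, $(a;q)_\infty:=\prod_{n\ge 0}(1-aq^n)$; thus, for a positive integer $j$, $(q^j;q^j)_\infty=\prod_{n\ge 1}(1-q^{jn})$ and $(-q^j;q^j)_\infty=\prod_{n\ge 1}(1+q^{jn})$. The integers $\overline{b}(n)$, $n\ge 0$, are the coefficients of the power series $\sum_{n=0}^{\infty}\overline{b}(n)q^n=\frac{(-q;q)_\infty^2(-q^2;q^2)_\infty^2}{(q;q)_\infty^2(q^2;q^2)_\infty^2}$. *)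

theory Defs
  imports "HOL-Analysis.Analysis" "HOL-Number_Theory.Cong"
begin

text \<open>
  The symbol $(a;q)_\infty$. It is used below in the ring of formal power series over the
  integers, with the library's metric on \<^typ>\<open>int fps\<close> giving the meaning of the infinite product.
\<close>

definition qpoch_inf :: "'a :: {t2_space, comm_ring_1} \<Rightarrow> 'a \<Rightarrow> 'a" where
  "qpoch_inf a q = (\<Prod>n. 1 - a * q ^ n)"

definition overcubic_pair_num :: "int fps" where
  "overcubic_pair_num =
     (qpoch_inf (- fps_X) fps_X)\<^sup>2 * (qpoch_inf (- (fps_X ^ 2)) (fps_X ^ 2))\<^sup>2"

definition overcubic_pair_den :: "int fps" where
  "overcubic_pair_den =
     (qpoch_inf fps_X fps_X)\<^sup>2 * (qpoch_inf (fps_X ^ 2) (fps_X ^ 2))\<^sup>2"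

text \<open>
  \<^typ>\<open>int fps\<close> has no division, so the quotient is formed with the library's inverse of a power
  series whose constant coefficient (here 1) has a given inverse. The lemma
  \<open>overcubic_pair_gf_mult_den\<close> below confirms that this is the quotient.
\<close>

definition overcubic_pair_gf :: "int fps" where
  "overcubic_pair_gf = overcubic_pair_num * fps_left_inverse overcubic_pair_den 1"

definition overcubic_pairs :: "nat \<Rightarrow> int" where
  "overcubic_pairs n = fps_nth overcubic_pair_gf n"

lemma qpoch_inf_fps:
  fixes a q :: "int fps"
  assumes a: "fps_nth a 0 = 0" and q: "fps_nth q 0 = 0"
  shows has_prod_qpoch_inf_fps: "(\<lambda>n. 1 - a * q ^ n) has_prod qpoch_inf a q"
    and qpoch_inf_fps_nth_0: "fps_nth (qpoch_inf a q) 0 = 1"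
proof -
  define P where "P n = (\<Prod>i\<le>n. 1 - a * q ^ i)" for n
  define L where "L = Abs_fps (\<lambda>k. fps_nth (P k) k)"
  have step: "fps_nth (P (Suc n)) k = fps_nth (P n) k" if "k \<le> n" for n k
  proof -
    have "P (Suc n) = P n - P n * a * q ^ Suc n"
      by (simp add: P_def algebra_simps)
    moreover have "fps_nth (P n * a * q ^ Suc n) k = 0"
    proof -
      have "fps_nth (q ^ Suc n) j = 0" if "j \<le> k" for j
        using startsby_zero_power_prefix[OF q, of "Suc n"] that \<open>k \<le> n\<close>
        by (meson le_imp_less_Suc le_trans)
      thus ?thesis
        unfolding fps_mult_nth by (intro sum.neutral) auto
    qed
    ultimately show ?thesis by simp
  qed
  have stable: "fps_nth (P n) k = fps_nth L k" if "k \<le> n" for n k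
    using that by (induction n rule: dec_induct) (simp_all add: L_def step)
  have lim: "P \<longlonglongrightarrow> L"
    by (rule tendsto_fpsI) (use stable eventually_ge_at_top in \<open>blast intro: eventually_mono\<close>)
  have L0: "fps_nth L 0 = 1"
    using a by (simp add: L_def P_def)
  hence "raw_has_prod (\<lambda>n. 1 - a * q ^ n) 0 L"
    using lim by (auto simp: raw_has_prod_def P_def[abs_def])
  hence hp: "(\<lambda>n. 1 - a * q ^ n) has_prod L"
    by (simp add: has_prod_def)
  have eq: "qpoch_inf a q = L"
    unfolding qpoch_inf_def prodinf_def
  proof (rule the_equality)
    show "(\<lambda>n. 1 - a * q ^ n) has_prod L" by (rule hp)
  next
    fix p assume p: "(\<lambda>n. 1 - a * q ^ n) has_prod p"
    have nz: "1 - a * q ^ i \<noteq> 0" for i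
    proof
      assume "1 - a * q ^ i = 0"
      hence "fps_nth (1 - a * q ^ i) 0 = 0" by simp
      thus False using a by simp
    qed
    have "P \<longlonglongrightarrow> p"
      using p nz by (auto simp: has_prod_def raw_has_prod_def P_def[abs_def])
    thus "p = L" using lim LIMSEQ_unique by blast
  qed
  show "(\<lambda>n. 1 - a * q ^ n) has_prod qpoch_inf a q"
    using hp eq by simp
  show "fps_nth (qpoch_inf a q) 0 = 1"
    using L0 eq by simp
qed

lemma overcubic_pair_gf_mult_den:
  "overcubic_pair_gf * overcubic_pair_den = overcubic_pair_num"
proof -
  have "fps_nth overcubic_pair_den 0 = 1"
    by (simp add: overcubic_pair_den_def qpoch_inf_fps_nth_0 fps_nth_power_0)
  hence "fps_left_inverse overcubic_pair_den 1 * overcubic_pair_den = 1"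
    by (intro fps_left_inverse) simp
  thus ?thesis
    by (simp add: overcubic_pair_gf_def mult.assoc)
qed

end

theory Submission
  imports Defs
begin

text \<open>
  Write $\vartheta(q) = \sum_{k} q^{k^2}$. By Gauss, $(q;q)_\infty / (-q;q)_\infty = \vartheta(-q)$,
  and with $\vartheta(q)\vartheta(-q) = \vartheta(-q^2)^2$ the generating function becomes
  $1 / (\vartheta(-q)^3 \vartheta(q))$. Its even-indexed coefficients have the generating function
  $\vartheta(q)^2 / \vartheta(-q)^6$, because
  $\vartheta(q)^2 + \vartheta(-q)^2 = 2\vartheta(q^2)^2$. Splitting $\vartheta$ into even and odd part,
  one finds $\overline{b}(2m) \equiv 2 r_4(m) \pmod{256}$ for odd $m$, where $r_4(m)$ counts the
  representations of $m$ as a sum of four squares. Now let $m = 3l$ with $l \equiv 3 \pmod 4$ and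
  $3 \nmid l$, as is the case here. Then $r_4(3l) = 4 r_4(l)$, and $32$ divides $r_4(l)$ since in each
  representation of $l$ exactly three of the four entries are odd. Hence $256$ divides $2 r_4(m)$.
\<close>

subsection \<open>Gauss's product formula for $\vartheta(-q)$\<close>

text \<open>
  A telescoping identity in the style of Shanks: modulo $q^{n+1}$ the second sum vanishes, which
  leaves Gauss's identity in the limit.
\<close>

lemma gauss_square_sum_finite:
  fixes q :: "'a :: comm_ring_1"
  shows "(\<Prod>k=1..n. 1 + q ^ k) * (1 + 2 * (\<Sum>j=1..n. (-1) ^ j * q ^ (j\<^sup>2))) =
    (\<Prod>k=1..n. 1 - q ^ k) +
    2 * (\<Sum>s=1..n. (-1) ^ s * q ^ (s * (n + 1)) *
      ((\<Prod>k=s+1..n. 1 - q ^ k) * (\<Prod>k=1..<s. 1 + q ^ k)))"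
proof (induction n)
  case 0
  then show ?case by simp
next
  case (Suc n)
  define N where "N m = (\<Prod>k=1..m. 1 + q ^ k)" for m
  define D where "D m = (\<Prod>k=1..m. 1 - q ^ k)" for m
  define C where "C s m = (\<Prod>k=s+1..m. 1 - q ^ k) * (\<Prod>k=1..<s. 1 + q ^ k)" for s m
  define A where "A m = 1 + 2 * (\<Sum>j=1..m. (-1) ^ j * q ^ (j\<^sup>2))" for m
  define Q where "Q = q ^ Suc n"
  define B where "B s = Q ^ (s + 1) * ((\<Prod>k=s+1..n. 1 - q ^ k) * N s)" for s
  define S where "S = (\<Sum>s=1..n. (-1) ^ s * q ^ (s * (n + 1)) * C s n)"
  have N_Suc: "N (Suc m) = (1 + q ^ Suc m) * N m" for m
    by (simp add: N_def)
  have C_Suc: "C s (Suc n) = (1 - Q) * C s n" if "s \<le> n" for s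
    using that by (simp add: C_def Q_def algebra_simps)
  have C_top: "C (Suc n) (Suc n) = N n"
    by (simp add: C_def N_def atLeastLessThanSuc_atLeastAtMost)
  \<comment> \<open>After removing the common factor \<open>Q ^ s * C s n\<close>, the left side is
    \<open>1 + Q - q ^ s * (1 - Q)\<close>, which regroups as
    \<open>(1 - q ^ s) + Q * (1 + q ^ s)\<close>. The two pieces are consecutive values of
    \<open>B\<close>, so the alternating sum over \<open>s\<close> telescopes.\<close>
  have key: "(1 + Q) * (q ^ (s * (n + 1)) * C s n) - q ^ (s * (n + 2)) * C s (Suc n)
      = B (s - 1) + B s" if "s \<in> {1..n}" for s
  proof -
    obtain r where s: "s = Suc r" using \<open>s \<in> {1..n}\<close> by (cases s) auto
    have R: "(\<Prod>k=Suc r..n. 1 - q ^ k) = (1 - q ^ s) * (\<Prod>k=Suc s..n. 1 - q ^ k)"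
      using \<open>s \<in> {1..n}\<close> s by (subst prod.atLeast_Suc_atMost) auto
    have Cs: "C s n = (\<Prod>k=Suc s..n. 1 - q ^ k) * N r"
      by (simp add: C_def N_def s atLeastLessThanSuc_atLeastAtMost)
    have Br: "B r = Q ^ s * ((1 - q ^ s) * C s n)"
    proof -
      have "B r = Q ^ Suc r * ((\<Prod>k=Suc r..n. 1 - q ^ k) * N r)"
        by (simp add: B_def)
      thus ?thesis
        unfolding R Cs unfolding s by (simp only: mult.assoc)
    qed
    have "N s = (1 + q ^ s) * N r"
      unfolding s by (rule N_Suc)
    hence Bs: "B s = Q ^ s * (Q * ((1 + q ^ s) * C s n))"
      unfolding B_def Cs by (simp add: mult_ac)
    have q1: "q ^ (s * (n + 1)) = Q ^ s"
      unfolding Q_def by (metis Suc_eq_plus1 power_mult mult.commute)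
    have q2: "q ^ (s * (n + 2)) = Q ^ s * q ^ s"
      unfolding q1 [symmetric] power_add [symmetric] by (simp add: add_ac)
    have "C s (Suc n) = (1 - Q) * C s n"
      using C_Suc that by simp
    hence "(1 + Q) * (q ^ (s * (n + 1)) * C s n) - q ^ (s * (n + 2)) * C s (Suc n) =
      (1 + Q) * (Q ^ s * C s n) - Q ^ s * q ^ s * ((1 - Q) * C s n)"
      by (simp only: q1 q2)
    also have "\<dots> = B r + B s"
      unfolding Br Bs by (simp add: algebra_simps)
    finally show ?thesis by (simp add: s)
  qed
  have tele: "(\<Sum>s=1..m. (-1) ^ s * (B (s - 1) + B s)) = (-1) ^ m * B m - B 0" for m
    by (induction m) (simp_all add: algebra_simps)
  have "(1 + Q) * S - (\<Sum>s=1..n. (-1) ^ s * q ^ (s * (n + 2)) * C s (Suc n))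
      = (\<Sum>s=1..n. (-1) ^ s * ((1 + Q) * (q ^ (s * (n + 1)) * C s n)
          - q ^ (s * (n + 2)) * C s (Suc n)))"
    unfolding S_def sum_distrib_left sum_subtractf [symmetric]
    by (intro sum.cong refl) (simp add: algebra_simps)
  also have "\<dots> = (-1) ^ n * B n - B 0"
    using key by (simp add: tele [symmetric])
  finally have diff: "(\<Sum>s=1..n. (-1) ^ s * q ^ (s * (n + 2)) * C s (Suc n)) =
      (1 + Q) * S - (-1) ^ n * B n + B 0"
    by (simp add: algebra_simps)
  have B0: "B 0 = Q * D n"
    by (simp add: B_def N_def D_def)
  have Bn: "B n = Q ^ (n + 1) * N n"
    by (simp add: B_def)
  have sq: "q ^ ((Suc n)\<^sup>2) = Q ^ (n + 1)"
    unfolding Q_def power_mult [symmetric] power2_eq_square by simp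
  have top: "q ^ (Suc n * (n + 2)) = Q ^ (n + 1) * Q"
    unfolding Q_def power_mult [symmetric] power_add [symmetric] by (simp add: algebra_simps)
  have IH: "N n * A n = D n + 2 * S"
    using Suc.IH by (simp add: N_def A_def D_def S_def C_def)
  have "N (Suc n) * A (Suc n) = (1 + Q) * (N n * A n) - 2 * (1 + Q) * (-1) ^ n * Q ^ (n + 1) * N n"
    unfolding N_Suc A_def Q_def [symmetric]
    by (simp add: sq algebra_simps del: power_Suc) (simp add: algebra_simps)
  \<comment> \<open>Here \<open>(1 + Q) * D n = (1 - Q) * D n + 2 * B 0\<close>. The factor
    \<open>1 + Q\<close> splits the new square term into the telescoping boundary \<open>B n\<close>
    and the summand for \<open>s = n + 1\<close>.\<close>
  also have "\<dots> = (1 - Q) * D n + 2 * ((1 + Q) * S - (-1) ^ n * B n + B 0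
      - (-1) ^ n * (Q ^ (n + 1) * Q) * N n)"
    unfolding IH B0 Bn by (simp add: algebra_simps)
  also have "\<dots> = D (Suc n) + 2 * (\<Sum>s=1..Suc n. (-1) ^ s * q ^ (s * (n + 2)) * C s (Suc n))"
  proof -
    have "(\<Sum>s=1..Suc n. (-1) ^ s * q ^ (s * (n + 2)) * C s (Suc n)) =
      (1 + Q) * S - (-1) ^ n * B n + B 0 + (-1) ^ Suc n * q ^ (Suc n * (n + 2)) * N n"
      by (simp only: diff [symmetric] C_top [symmetric] sum.cl_ivl_Suc) simp
    moreover have "D (Suc n) = (1 - Q) * D n"
      by (simp add: D_def Q_def)
    ultimately show ?thesis unfolding top by simp
  qed
  finally show ?case
    by (simp only: N_def A_def D_def C_def) simp
qed

section \<open>Truncation of infinite products, and substitution of powers of q\<close>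

lemma fps_mult_nth_cong:
  assumes "\<And>i. i \<le> k \<Longrightarrow> fps_nth f i = fps_nth f' i"
    and "\<And>i. i \<le> k \<Longrightarrow> fps_nth g i = fps_nth g' i"
  shows "fps_nth (f * g) k = fps_nth (f' * g') k"
  unfolding fps_mult_nth using assms by (intro sum.cong) auto

text \<open>Both \<open>a\<close> and \<open>q\<close> lack a constant term, so
  \<open>a * q ^ n\<close> starts in degree \<open>n + 1\<close> or later. Hence the
  \<open>n\<close> factors with \<open>i < n\<close> settle every coefficient up to and including
  \<open>n\<close>.\<close>

lemma qpoch_inf_fps_nth:
  fixes a q :: "int fps"
  assumes a: "fps_nth a 0 = 0" and q: "fps_nth q 0 = 0" and k: "k \<le> n"
  shows "fps_nth (qpoch_inf a q) k = fps_nth (\<Prod>i<n. 1 - a * q ^ i) k"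
proof -
  define P where "P n = (\<Prod>i<n. 1 - a * q ^ i)" for n
  have step: "fps_nth (P (Suc n)) k = fps_nth (P n) k" if "k \<le> n" for n
  proof -
    have "fps_nth (a * q ^ n) j = 0" if "j \<le> k" for j
    proof (cases "j = 0")
      case False
      have "fps_nth (q ^ n) i = 0" if "i < n" for i
        using startsby_zero_power_prefix [OF q, of n] that by blast
      moreover have "fps_nth a 0 = 0" by (rule a)
      ultimately have "fps_nth a l * fps_nth (q ^ n) (j - l) = 0" if "l \<le> j" for l
        using that False \<open>j \<le> k\<close> \<open>k \<le> n\<close> by (cases "l = 0") auto
      thus ?thesis
        unfolding fps_mult_nth by (intro sum.neutral) auto
    qed (simp add: a)
    hence "fps_nth (P n * (1 - a * q ^ n)) k = fps_nth (P n * 1) k"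
      by (intro fps_mult_nth_cong) auto
    thus ?thesis by (simp add: P_def)
  qed
  have stable: "fps_nth (P m) k = fps_nth (P n) k" if "n \<le> m" for m
    using that k by (induction m rule: dec_induct) (simp_all add: step)
  have "P \<longlonglongrightarrow> qpoch_inf a q"
    unfolding P_def [abs_def]
    by (rule has_prod_imp_tendsto' [OF has_prod_qpoch_inf_fps [OF a q]])
  hence "\<forall>\<^sub>F m in sequentially. fps_nth (P m) k = fps_nth (qpoch_inf a q) k"
    by (simp add: tendsto_fps_iff)
  hence "\<forall>\<^sub>F m in sequentially. fps_nth (P n) k = fps_nth (qpoch_inf a q) k"
    using eventually_ge_at_top [of n] by eventually_elim (metis stable)
  thus ?thesis by (simp add: P_def)
qed

lemma fps_compose_X_power_nth:
  fixes f :: "'a :: comm_ring_1 fps"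
  assumes "j > 0"
  shows "fps_nth (f oo fps_X ^ j) n = (if j dvd n then fps_nth f (n div j) else 0)"
proof -
  have "fps_nth (f oo fps_X ^ j) n = (\<Sum>i=0..n. fps_nth f i * (if n = j * i then 1 else 0))"
    by (simp add: fps_compose_nth power_mult [symmetric])
  also have "\<dots> = (\<Sum>i\<in>{i\<in>{0..n}. n = j * i}. fps_nth f i)"
    by (subst sum.inter_filter) (auto intro!: sum.cong)
  also have "{i\<in>{0..n}. n = j * i} = (if j dvd n then {n div j} else {})"
    using assms by auto
  finally show ?thesis by auto
qed

text \<open>Each coefficient comes from a finite product, which substitution passes through as a
  ring homomorphism. With \<open>j = 2\<close> this yields the factors in q^2 from those in
  q.\<close>

lemma qpoch_inf_compose_X_power:
  fixes a q :: "int fps"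
  assumes a: "fps_nth a 0 = 0" and q: "fps_nth q 0 = 0" and j: "j > 0"
  shows "qpoch_inf (a oo fps_X ^ j) (q oo fps_X ^ j) = qpoch_inf a q oo fps_X ^ j"
proof (rule fps_ext)
  fix n
  have X0: "fps_nth (fps_X ^ j :: int fps) 0 = 0" using j by simp
  have "fps_nth (qpoch_inf (a oo fps_X ^ j) (q oo fps_X ^ j)) n
     = fps_nth (\<Prod>i<n. 1 - (a oo fps_X ^ j) * (q oo fps_X ^ j) ^ i) n"
    using a q by (intro qpoch_inf_fps_nth) auto
  also have "(\<Prod>i<n. 1 - (a oo fps_X ^ j) * (q oo fps_X ^ j) ^ i)
    = (\<Prod>i<n. 1 - a * q ^ i) oo fps_X ^ j"
    unfolding fps_compose_prod_distrib [OF X0] fps_compose_sub_distrib fps_compose_mult_distrib [OF X0]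
      fps_compose_power [OF X0] fps_compose_1 ..
  also have "fps_nth \<dots> n = fps_nth (qpoch_inf a q oo fps_X ^ j) n"
    using j by (simp add: fps_compose_X_power_nth qpoch_inf_fps_nth [OF a q, of _ n])
  finally show "fps_nth (qpoch_inf (a oo fps_X ^ j) (q oo fps_X ^ j)) n = \<dots>" .
qed

section \<open>Generating functions of weights, and the theta series\<close>

definition count_fps :: "('a \<Rightarrow> nat) \<Rightarrow> int fps" where
  "count_fps e = Abs_fps (\<lambda>n. int (card {x. e x = n}))"

lemma count_fps_nth [simp]: "fps_nth (count_fps e) n = int (card {x. e x = n})"
  by (simp add: count_fps_def)

text \<open>Sorting pairs by the weight \<open>i\<close> of the first component gives the Cauchy
  product. Finite fibres are assumed because \<open>card\<close> gives 0 on infinite sets.\<close>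

lemma
  assumes "\<And>n. finite {x. e x = n}" and "\<And>n. finite {y. e' y = n}"
  shows finite_fibres_add: "finite {z. e (fst z) + e' (snd z) = n}"
    and count_fps_mult: "count_fps e * count_fps e' = count_fps (\<lambda>z. e (fst z) + e' (snd z))"
proof -
  have fib: "{z. e (fst z) + e' (snd z) = m} = (\<Union>i\<in>{0..m}. {x. e x = i} \<times> {y. e' y = m - i})" for m
    by auto
  show "finite {z. e (fst z) + e' (snd z) = n}"
    unfolding fib using assms by auto
  have "card {z. e (fst z) + e' (snd z) = m} = (\<Sum>i=0..m. card ({x. e x = i} \<times> {y. e' y = m - i}))" for m
    unfolding fib using assms by (intro card_UN_disjoint) auto
  thus "count_fps e * count_fps e' = count_fps (\<lambda>z. e (fst z) + e' (snd z))"
    by (intro fps_ext) (simp add: fps_mult_nth card_cartesian_product)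
qed

definition theta :: "int fps" where
  "theta = count_fps (\<lambda>k::int. nat (k\<^sup>2))"

lemma finite_square_fibre: "finite {k::int. nat (k\<^sup>2) = n}"
proof (rule finite_subset)
  show "{k::int. nat (k\<^sup>2) = n} \<subseteq> {- int n..int n}"
  proof
    fix k :: int assume "k \<in> {k. nat (k\<^sup>2) = n}"
    hence "k\<^sup>2 = int n" by auto
    moreover have "\<bar>k\<bar> \<le> k\<^sup>2"
      using self_le_power [of "\<bar>k\<bar>" 2] by (cases "k = 0") auto
    ultimately show "k \<in> {- int n..int n}" by auto
  qed
qed simp

lemma theta_nth: "fps_nth theta n = (if n = 0 then 1 else if \<exists>j. n = j\<^sup>2 then 2 else 0)"
proof (cases "\<exists>j. n = j\<^sup>2")
  case True
  then obtain j where j: "n = j\<^sup>2" ..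
  have "{k::int. nat (k\<^sup>2) = n} = {int j, - int j}"
  proof -
    have "nat (k\<^sup>2) = n \<longleftrightarrow> k\<^sup>2 = (int j)\<^sup>2" for k :: int
      by (auto simp: j nat_eq_iff)
    thus ?thesis by (auto simp: power2_eq_iff)
  qed
  thus ?thesis using j by (auto simp: theta_def)
next
  case False
  have "nat (k\<^sup>2) \<noteq> n" for k :: int
    using False by (metis nat_power_eq abs_ge_zero power2_abs)
  moreover have "n \<noteq> 0" using False by (metis zero_power2)
  ultimately show ?thesis using False by (simp add: theta_def)
qed

abbreviation fps_neg_arg :: "int fps \<Rightarrow> int fps" where
  "fps_neg_arg f \<equiv> f oo (- fps_X)"

text \<open>As \<open>j \<le> j\<^sup>2\<close>, squares of \<open>j > n\<close> do not reach degree
  \<open>n\<close>; as \<open>j\<close> and its square have the same parity, the alternating signs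
  are those of q -> -q.\<close>

lemma theta_neg_partial_sum:
  assumes "i \<le> n"
  shows "fps_nth (1 + 2 * (\<Sum>j=1..n. (-1) ^ j * fps_X ^ (j\<^sup>2))) i = fps_nth (fps_neg_arg theta) i"
proof -
  have m1: "fps_nth ((-1) ^ j * f) i = (-1) ^ j * fps_nth f i" for j and f :: "int fps"
    by (cases "even j") auto
  have "fps_nth (\<Sum>j=1..n. (-1) ^ j * fps_X ^ (j\<^sup>2) :: int fps) i
      = (\<Sum>j=1..n. (if i = j\<^sup>2 then (-1) ^ j else 0))"
    unfolding fps_sum_nth m1 by (intro sum.cong) auto
  also have "\<dots> = (if i \<noteq> 0 \<and> (\<exists>j. i = j\<^sup>2) then (-1) ^ i else 0)"
  proof (cases "i \<noteq> 0 \<and> (\<exists>j. i = j\<^sup>2)")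
    case True
    then obtain j where j: "i = j\<^sup>2" "j \<noteq> 0" by auto
    have "j \<le> j\<^sup>2" by (simp add: power2_eq_square)
    hence "j \<in> {1..n}" using j assms by auto
    have "(\<Sum>j=1..n. (if i = j\<^sup>2 then (-1) ^ j else 0)) = (\<Sum>k=1..n. (if k = j then (-1) ^ j else 0 :: int))"
      by (intro sum.cong) (auto simp: j)
    also have "\<dots> = (-1) ^ j"
      using \<open>j \<in> {1..n}\<close> by simp
    also have "\<dots> = (-1) ^ i"
      by (simp add: j minus_one_power_iff)
    finally show ?thesis using True by simp
  next
    case False
    thus ?thesis by (auto intro!: sum.neutral)
  qed
  finally have "fps_nth (\<Sum>j=1..n. (-1) ^ j * fps_X ^ (j\<^sup>2) :: int fps) i = \<dots>" .
  thus ?thesis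
    by (auto simp: fps_compose_uminus' theta_nth numeral_fps_const)
qed

text \<open>Coefficient \<open>k\<close> of every series involved is read off the finite identity
  taken at \<open>n = k\<close>.\<close>

lemma gauss_square_sum:
  "qpoch_inf (- fps_X) fps_X * fps_neg_arg theta = qpoch_inf fps_X fps_X"
proof (rule fps_ext)
  fix k
  let ?N = "\<Prod>i=1..k. 1 + fps_X ^ i :: int fps" and ?D = "\<Prod>i=1..k. 1 - fps_X ^ i :: int fps"
  let ?A = "1 + 2 * (\<Sum>j=1..k. (-1) ^ j * fps_X ^ (j\<^sup>2)) :: int fps"
  let ?R = "\<lambda>s. (\<Prod>i=s+1..k. 1 - fps_X ^ i) * (\<Prod>i=1..<s. 1 + fps_X ^ i) :: int fps"
  have shift: "(\<Prod>i<k. h (Suc i)) = (\<Prod>i=1..k. h i)" for h :: "nat \<Rightarrow> int fps"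
    by (rule prod.reindex_bij_witness [of _ "\<lambda>i. i - 1" Suc]) auto
  have N: "fps_nth (qpoch_inf (- fps_X) fps_X) i = fps_nth ?N i" if "i \<le> k" for i
    using that by (subst qpoch_inf_fps_nth [of _ _ _ k]) (simp_all add: shift [of "\<lambda>i. 1 + fps_X ^ i", unfolded One_nat_def] flip: power_Suc)
  have D: "fps_nth (qpoch_inf fps_X fps_X) i = fps_nth ?D i" if "i \<le> k" for i
    using that by (subst qpoch_inf_fps_nth [of _ _ _ k]) (simp_all add: shift [of "\<lambda>i. 1 - fps_X ^ i", unfolded One_nat_def] flip: power_Suc)
  have "fps_nth (qpoch_inf (- fps_X) fps_X * fps_neg_arg theta) k = fps_nth (?N * ?A) k"
    using N theta_neg_partial_sum by (intro fps_mult_nth_cong) auto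
  also have "?N * ?A = ?D + 2 * (\<Sum>s=1..k. (-1) ^ s * fps_X ^ (s * (k + 1)) * ?R s)"
    by (rule gauss_square_sum_finite)
  also have "fps_nth \<dots> k = fps_nth ?D k"
  proof -
    have "fps_nth ((-1) ^ s * fps_X ^ (s * (k + 1)) * ?R s) k = 0" if "s \<in> {1..k}" for s
    proof -
      have "k < s * (k + 1)" using that by (cases s) auto
      hence "fps_nth (fps_X ^ (s * (k + 1)) * ((-1) ^ s * ?R s)) k = 0"
        by (subst fps_X_power_mult_nth) simp
      thus ?thesis by (simp only: mult_ac)
    qed
    hence "fps_nth (\<Sum>s=1..k. (-1) ^ s * fps_X ^ (s * (k + 1)) * ?R s) k = 0"
      unfolding fps_sum_nth by (intro sum.neutral) blast
    thus ?thesis by (simp add: numeral_fps_const)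
  qed
  also have "\<dots> = fps_nth (qpoch_inf fps_X fps_X) k"
    by (simp add: D)
  finally show "fps_nth (qpoch_inf (- fps_X) fps_X * fps_neg_arg theta) k = fps_nth (qpoch_inf fps_X fps_X) k" .
qed

subsection \<open>Quadratic identities for $\vartheta$\<close>

lemma theta_power2: "theta\<^sup>2 = count_fps (\<lambda>z::int \<times> int. nat ((fst z)\<^sup>2) + nat ((snd z)\<^sup>2))"
  unfolding theta_def power2_eq_square [of "count_fps _"]
  by (rule count_fps_mult) (rule finite_square_fibre)+

lemma theta_power2_nth:
  "fps_nth (theta\<^sup>2) n = int (card {(x::int, y::int). x\<^sup>2 + y\<^sup>2 = int n})"
proof -
  have "nat (x\<^sup>2) + nat (y\<^sup>2) = n \<longleftrightarrow> x\<^sup>2 + y\<^sup>2 = int n" for x y :: int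
    by (simp add: nat_eq_iff flip: nat_add_distrib)
  thus ?thesis by (simp add: theta_power2 case_prod_unfold)
qed

text \<open>The map sends u + iv to (1 + i)(u - iv), which doubles the norm. It is onto because an
  even \<open>x\<^sup>2 + y\<^sup>2\<close> forces \<open>x + y\<close> to be even. Both quadratic
  identities for theta rest on this.\<close>

lemma card_two_squares_double:
  "card {(x::int, y::int). x\<^sup>2 + y\<^sup>2 = 2 * m} = card {(x::int, y::int). x\<^sup>2 + y\<^sup>2 = m}"
proof (rule sym, rule bij_betw_same_card [of "\<lambda>(u, v). (u + v, u - v)"])
  show "bij_betw (\<lambda>(u, v). (u + v, u - v)) {(x::int, y). x\<^sup>2 + y\<^sup>2 = m} {(x, y). x\<^sup>2 + y\<^sup>2 = 2 * m}"
  proof (rule bij_betw_imageI)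
    show "(\<lambda>(u, v). (u + v, u - v)) ` {(x::int, y). x\<^sup>2 + y\<^sup>2 = m} = {(x, y). x\<^sup>2 + y\<^sup>2 = 2 * m}" (is "?f ` ?B = ?A")
    proof (rule equalityI [OF _ subsetI])
      fix z assume "z \<in> ?A"
      then obtain x y where z: "z = (x, y)" and eq: "x\<^sup>2 + y\<^sup>2 = 2 * m"
        by auto
      have "even (x\<^sup>2 + y\<^sup>2)" using eq by simp
      hence "even (x + y)" by simp
      then obtain u where u: "x + y = 2 * u" ..
      hence v: "x - y = 2 * (u - y)" by simp
      have "(2 * u)\<^sup>2 + (2 * (u - y))\<^sup>2 = 2 * (x\<^sup>2 + y\<^sup>2)"
        unfolding u [symmetric] v [symmetric] by (simp add: power2_eq_square algebra_simps)
      hence "(u, u - y) \<in> ?B"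
        unfolding power_mult_distrib using eq by simp
      moreover have "z = ?f (u, u - y)"
        using u z by simp
      ultimately show "z \<in> ?f ` ?B" by (rule image_eqI [rotated])
    qed (auto simp: power2_eq_square algebra_simps)
  qed (auto simp: inj_on_def)
qed

lemma theta_power2_nth_double: "fps_nth (theta\<^sup>2) (2 * n) = fps_nth (theta\<^sup>2) n"
  using card_two_squares_double [of "int n"] by (simp add: theta_power2_nth)

lemma fps_neg_arg_mult: "fps_neg_arg (f * g) = fps_neg_arg f * fps_neg_arg g"
  by (simp add: fps_compose_mult_distrib)

lemma fps_neg_arg_power: "fps_neg_arg (f ^ n) = fps_neg_arg f ^ n"
  by (simp add: fps_compose_power)

lemma fps_neg_arg_neg_arg [simp]: "fps_neg_arg (fps_neg_arg f) = f"
  by (rule fps_ext) (simp add: fps_compose_uminus' flip: power_mult_distrib mult.assoc)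

abbreviation fps_sq_arg :: "int fps \<Rightarrow> int fps" where
  "fps_sq_arg f \<equiv> f oo fps_X\<^sup>2"

lemma fps_sq_arg_nth: "fps_nth (fps_sq_arg f) n = (if even n then fps_nth f (n div 2) else 0)"
  by (rule fps_compose_X_power_nth) simp

lemma fps_sq_arg_mult: "fps_sq_arg (f * g) = fps_sq_arg f * fps_sq_arg g"
  by (simp add: fps_compose_mult_distrib)

lemma fps_sq_arg_power: "fps_sq_arg (f ^ n) = fps_sq_arg f ^ n"
  by (simp add: fps_compose_power)

lemma fps_sq_arg_inject: "fps_sq_arg f = fps_sq_arg g \<longleftrightarrow> f = g"
proof
  assume eq: "fps_sq_arg f = fps_sq_arg g"
  show "f = g"
  proof (rule fps_ext)
    fix n show "fps_nth f n = fps_nth g n"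
      using arg_cong [OF eq, of "\<lambda>h. fps_nth h (2 * n)"] by (simp add: fps_sq_arg_nth)
  qed
qed simp

text \<open>Odd coefficients cancel and even ones double; the doubling rule for two squares then
  halves the index.\<close>

lemma theta_add_neg: "theta\<^sup>2 + (fps_neg_arg theta)\<^sup>2 = 2 * fps_sq_arg (theta\<^sup>2)"
proof (rule fps_ext)
  fix n
  have "fps_nth ((fps_neg_arg theta)\<^sup>2) n = (-1) ^ n * fps_nth (theta\<^sup>2) n"
    unfolding fps_neg_arg_power [symmetric] by (simp add: fps_compose_uminus')
  moreover have "fps_nth (theta\<^sup>2) n = fps_nth (theta\<^sup>2) (n div 2)" if "even n"
    using theta_power2_nth_double [of "n div 2"] that by simp
  ultimately show "fps_nth (theta\<^sup>2 + (fps_neg_arg theta)\<^sup>2) n = fps_nth (2 * fps_sq_arg (theta\<^sup>2)) n"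
    by (simp add: fps_sq_arg_nth numeral_fps_const)
qed

lemma square_nat_mod_4: "(j::nat)\<^sup>2 mod 4 = (if even j then 0 else 1)"
proof (cases "even j")
  case True
  then obtain k where "j = 2 * k" ..
  thus ?thesis by (simp add: power_mult_distrib)
next
  case False
  then obtain k where "j = 2 * k + 1" by (rule oddE)
  hence "j\<^sup>2 = 4 * (k\<^sup>2 + k) + 1" by (simp add: power2_eq_square algebra_simps)
  thus ?thesis using False by simp
qed

lemma theta_nth_eq_0: "fps_nth theta n = 0" if "n mod 4 \<noteq> 0" "n mod 4 \<noteq> 1"
  using that by (auto simp: theta_nth square_nat_mod_4 split: if_splits)

text \<open>An even sum forces \<open>i\<close> and \<open>k\<close> to be congruent modulo 4. Thus
  for two squares the sign \<open>(-1) ^ k\<close> depends only on the sum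
  \<open>i + k\<close>.\<close>

lemma even_half_sum_iff:
  fixes i k :: nat
  assumes "i mod 4 \<in> {0, 1}" "k mod 4 \<in> {0, 1}" "even (i + k)"
  shows "even k \<longleftrightarrow> even ((i + k) div 2)"
proof -
  obtain c d r s where i: "i = 4 * c + r" and k: "k = 4 * d + s" and "r \<in> {0, 1}" "s \<in> {0, 1}"
    using assms by (metis mult_div_mod_eq)
  moreover have "even (r + s)"
    using assms(3) unfolding i k by simp
  ultimately have "r = s" by auto
  hence "(i + k) div 2 = 2 * (c + d) + s" unfolding i k by simp
  thus ?thesis by (simp add: k)
qed

text \<open>In even degree \<open>n\<close> all nonzero terms of the Cauchy product carry the same
  sign \<open>(-1) ^ (n div 2)\<close>, leaving a signed coefficient of
  \<open>theta\<^sup>2\<close>. In odd degree, swapping \<open>i\<close> and \<open>n - i\<close>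
  shows that the sum equals its own negative.\<close>

lemma theta_mult_neg: "theta * fps_neg_arg theta = (fps_sq_arg (fps_neg_arg theta))\<^sup>2"
proof (rule fps_ext)
  fix n
  let ?t = "fps_nth theta"
  have sq: "fps_nth (theta\<^sup>2) n = (\<Sum>i=0..n. ?t i * ?t (n - i))"
    by (simp add: power2_eq_square fps_mult_nth)
  have lhs: "fps_nth (theta * fps_neg_arg theta) n = (\<Sum>i=0..n. (-1) ^ (n - i) * (?t i * ?t (n - i)))"
    by (simp add: fps_mult_nth fps_compose_uminus' mult_ac)
  have rhs: "fps_nth ((fps_sq_arg (fps_neg_arg theta))\<^sup>2) n
     = (if even n then (-1) ^ (n div 2) * fps_nth (theta\<^sup>2) (n div 2) else 0)"
    unfolding fps_sq_arg_power [symmetric] fps_neg_arg_power [symmetric] fps_sq_arg_nth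
    by (simp add: fps_compose_uminus')
  show "fps_nth (theta * fps_neg_arg theta) n = fps_nth ((fps_sq_arg (fps_neg_arg theta))\<^sup>2) n"
  proof (cases "even n")
    case True
    have "(-1) ^ (n - i) * (?t i * ?t (n - i)) = (-1) ^ (n div 2) * (?t i * ?t (n - i))" if "i \<le> n" for i
    proof (cases "?t i = 0 \<or> ?t (n - i) = 0")
      case False
      hence "i mod 4 \<in> {0, 1}" "(n - i) mod 4 \<in> {0, 1}"
        using theta_nth_eq_0 by auto
      hence "even (n - i) \<longleftrightarrow> even (n div 2)"
        using even_half_sum_iff [of i "n - i"] that True by simp
      thus ?thesis by (simp add: minus_one_power_iff)
    qed auto
    hence "fps_nth (theta * fps_neg_arg theta) n = (-1) ^ (n div 2) * fps_nth (theta\<^sup>2) n"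
      unfolding lhs sq sum_distrib_left by (intro sum.cong) auto
    thus ?thesis
      using theta_power2_nth_double [of "n div 2"] True unfolding rhs by simp
  next
    case False
    have "(\<Sum>i=0..n. (-1) ^ (n - i) * (?t i * ?t (n - i)))
        = (\<Sum>i=0..n. (-1) ^ (n - (n - i)) * (?t (n - i) * ?t (n - (n - i))))"
      by (rule sum.reindex_bij_witness [of _ "\<lambda>i. n - i" "\<lambda>i. n - i"]) auto
    also have "\<dots> = (\<Sum>i=0..n. - ((-1) ^ (n - i) * (?t i * ?t (n - i))))"
      using False by (intro sum.cong) (auto simp: minus_one_power_iff)
    finally show ?thesis
      using False unfolding rhs lhs sum_negf by simp
  qed
qed

subsection \<open>Reduction to sums of four squares\<close>

definition fps_even_coeffs :: "int fps \<Rightarrow> int fps" where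
  "fps_even_coeffs f = Abs_fps (\<lambda>n. fps_nth f (2 * n))"

definition fps_odd_part :: "int fps \<Rightarrow> int fps" where
  "fps_odd_part f = Abs_fps (\<lambda>n. if odd n then fps_nth f n else 0)"

lemma add_fps_neg_arg: "f + fps_neg_arg f = 2 * fps_sq_arg (fps_even_coeffs f)"
  by (rule fps_ext)
     (auto simp: fps_even_coeffs_def fps_sq_arg_nth fps_compose_uminus' numeral_fps_const)

lemma diff_fps_neg_arg: "f - fps_neg_arg f = 2 * fps_odd_part f"
  by (rule fps_ext) (auto simp: fps_odd_part_def fps_compose_uminus' numeral_fps_const)

lemma overcubic_pair_gf_mult_theta:
  "overcubic_pair_gf * (fps_neg_arg theta ^ 3 * theta) = 1"
proof -
  define N D T where "N = qpoch_inf (- fps_X :: int fps) fps_X" and "D = qpoch_inf (fps_X :: int fps) fps_X"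
    and "T = fps_neg_arg theta"
  have gauss: "N * T = D"
    unfolding N_def D_def T_def by (rule gauss_square_sum)
  hence gauss2: "fps_sq_arg N * fps_sq_arg T = fps_sq_arg D"
    by (simp flip: fps_sq_arg_mult)
  have N2: "qpoch_inf (- (fps_X ^ 2)) (fps_X ^ 2) = fps_sq_arg N"
    using qpoch_inf_compose_X_power [of "- fps_X" fps_X 2] by (simp add: N_def fps_compose_uminus)
  have D2: "qpoch_inf (fps_X ^ 2) (fps_X ^ 2) = fps_sq_arg D"
    using qpoch_inf_compose_X_power [of fps_X fps_X 2] by (simp add: D_def)
  \<comment> \<open>\<open>U\<close> is the numerator and, since \<open>D = N * T\<close>, also a
    factor of the denominator. Its constant coefficient 1 makes it cancellable in the integral
    domain \<open>int fps\<close>.\<close>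
  define U where "U = (N * fps_sq_arg N)\<^sup>2"
  have "fps_nth U 0 = 1"
    by (simp add: U_def N_def qpoch_inf_fps_nth_0 fps_nth_power_0)
  hence "U \<noteq> 0" by auto
  have "overcubic_pair_num = U"
    unfolding overcubic_pair_num_def N2 N_def [symmetric] U_def by (simp add: power_mult_distrib)
  moreover have "overcubic_pair_den = (T\<^sup>2 * (fps_sq_arg T)\<^sup>2) * U"
    unfolding overcubic_pair_den_def D2 D_def [symmetric] gauss [symmetric] gauss2 [symmetric] U_def
    by (simp add: power_mult_distrib mult_ac fps_sq_arg_mult)
  moreover have "T\<^sup>2 * (fps_sq_arg T)\<^sup>2 = T ^ 3 * theta"
    unfolding T_def theta_mult_neg [symmetric] by (simp add: power2_eq_square power3_eq_cube mult_ac)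
  ultimately have "(overcubic_pair_gf * (T ^ 3 * theta)) * U = 1 * U"
    using overcubic_pair_gf_mult_den by (simp add: mult.assoc)
  thus ?thesis
    using \<open>U \<noteq> 0\<close> unfolding T_def mult_cancel_right by blast
qed

text \<open>The even part of a series is half of its sum with its image under q -> -q. Multiplying
  by \<open>(T * T') ^ 3\<close>, which is symmetric under this substitution and a series in q^2,
  clears both denominators at once.\<close>

lemma overcubic_pair_even_coeffs_mult_theta:
  "fps_even_coeffs overcubic_pair_gf * fps_neg_arg theta ^ 6 = theta\<^sup>2"
proof -
  define B T T' G where "B = overcubic_pair_gf" and "T = theta" and "T' = fps_neg_arg theta"
    and "G = fps_even_coeffs overcubic_pair_gf"
  have T'': "fps_neg_arg T' = T" by (simp add: T_def T'_def)
  have 1: "B * (T' ^ 3 * T) = 1"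
    unfolding B_def T_def T'_def by (rule overcubic_pair_gf_mult_theta)
  hence "fps_neg_arg (B * (T' ^ 3 * T)) = 1"
    by simp
  hence 2: "fps_neg_arg B * (T ^ 3 * T') = 1"
    unfolding fps_neg_arg_mult fps_neg_arg_power T'' by (simp add: T'_def T_def)
  have "2 * fps_sq_arg (G * T' ^ 6) = 2 * fps_sq_arg G * ((fps_sq_arg T')\<^sup>2) ^ 3"
    by (simp add: fps_sq_arg_mult fps_sq_arg_power mult.assoc)
  also have "\<dots> = (B + fps_neg_arg B) * (T * T') ^ 3"
    unfolding add_fps_neg_arg B_def G_def T_def T'_def theta_mult_neg ..
  also have "\<dots> = (B * (T' ^ 3 * T)) * T\<^sup>2 + (fps_neg_arg B * (T ^ 3 * T')) * T'\<^sup>2"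
    by algebra
  also have "\<dots> = 2 * fps_sq_arg (T\<^sup>2)"
    unfolding 1 2 unfolding T_def T'_def by (simp add: theta_add_neg)
  finally have "fps_sq_arg (G * T' ^ 6) = fps_sq_arg (T\<^sup>2)"
    by simp
  thus ?thesis
    unfolding fps_sq_arg_inject G_def T_def T'_def .
qed

section \<open>The congruence modulo 256 for the even-indexed coefficients\<close>

definition theta_even :: "int fps" where
  "theta_even = Abs_fps (\<lambda>n. if even n then fps_nth theta n else 0)"

text \<open>Half of the odd part of \<open>theta\<close>: opposite roots pair up, so the odd part
  has coefficients 0 and 2. The factor 2 made explicit here supplies the powers of 2 below.\<close>

definition theta_half_odd :: "int fps" where
  "theta_half_odd = Abs_fps (\<lambda>n. if odd n \<and> (\<exists>j. n = j\<^sup>2) then 1 else 0)"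

lemma theta_split:
  "theta = theta_even + 2 * theta_half_odd"
  "fps_neg_arg theta = theta_even - 2 * theta_half_odd"
  by (rule fps_ext; auto simp: theta_even_def theta_half_odd_def theta_nth numeral_fps_const fps_compose_uminus')+

lemma theta_even_eq: "\<exists>u. theta_even = 1 + 2 * u"
proof
  show "theta_even = 1 + 2 * Abs_fps (\<lambda>n. if even n \<and> n \<noteq> 0 \<and> (\<exists>j. n = j\<^sup>2) then 1 else 0)"
    by (rule fps_ext) (auto simp: theta_even_def theta_nth numeral_fps_const)
qed

text \<open>Clearing denominators gives \<open>H * D\<close> as half of
  \<open>T ^ 8 - T' ^ 8\<close>, that is, \<open>T ^ 4 - T' ^ 4 = 16 * a * w\<close> times
  \<open>a\<^sup>2 + 16 * w\<^sup>2\<close>. The last factor is congruent to \<open>D\<close> modulo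
  16, and the unit \<open>D\<close> cancels.\<close>

lemma odd_part_even_coeffs_cong_theta_power4:
  "256 dvd fps_odd_part (fps_even_coeffs overcubic_pair_gf) - (theta ^ 4 - fps_neg_arg theta ^ 4)"
proof -
  define T T' G H where "T = theta" and "T' = fps_neg_arg theta"
    and "G = fps_even_coeffs overcubic_pair_gf" and "H = fps_odd_part G"
  have T'': "fps_neg_arg T' = T" by (simp add: T_def T'_def)
  have 1: "G * T' ^ 6 = T\<^sup>2"
    unfolding G_def T_def T'_def by (rule overcubic_pair_even_coeffs_mult_theta)
  hence "fps_neg_arg (G * T' ^ 6) = fps_neg_arg (T\<^sup>2)"
    by simp
  hence 2: "fps_neg_arg G * T ^ 6 = T'\<^sup>2"
    unfolding fps_neg_arg_mult fps_neg_arg_power T'' by (simp add: T'_def T_def)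
  obtain u where u: "theta_even = 1 + 2 * u"
    using theta_even_eq ..
  define v where "v = theta_half_odd"
  have T: "T = 1 + 2 * u + 2 * v" and T': "T' = 1 + 2 * u - 2 * v"
    unfolding T_def T'_def v_def using theta_split [unfolded u] .
  \<comment> \<open>\<open>a\<close> and \<open>4 * w\<close> are the even and odd parts of
    \<open>T\<^sup>2\<close>, and \<open>a\<close> is 1 modulo 4.\<close>
  define w where "w = (1 + 2 * u) * v"
  define b where "b = u + u\<^sup>2 + v\<^sup>2"
  define a where "a = 1 + 4 * b"
  have T2: "T\<^sup>2 = a + 4 * w" and T'2: "T'\<^sup>2 = a - 4 * w"
    unfolding T T' a_def b_def w_def by (simp_all add: power2_eq_square algebra_simps)
  define D where "D = (T * T') ^ 6"
  have D: "D = (a\<^sup>2 - 16 * w\<^sup>2) ^ 3"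
  proof -
    have "D = (T\<^sup>2 * T'\<^sup>2) ^ 3"
      by (simp add: D_def power_mult_distrib)
    also have "T\<^sup>2 * T'\<^sup>2 = a\<^sup>2 - 16 * w\<^sup>2"
      unfolding T2 T'2 by (simp add: power2_eq_square algebra_simps)
    finally show ?thesis .
  qed
  have "2 * (H * D) = (G - fps_neg_arg G) * D"
    unfolding diff_fps_neg_arg H_def by (simp add: mult.assoc)
  also have "\<dots> = (G * T' ^ 6) * T ^ 6 - (fps_neg_arg G * T ^ 6) * T' ^ 6"
    unfolding D_def by algebra
  also have "\<dots> = (T\<^sup>2) ^ 4 - (T'\<^sup>2) ^ 4"
    unfolding 1 2 by algebra
  also have "\<dots> = 2 * (16 * a * w * (a\<^sup>2 + 16 * w\<^sup>2))"
    unfolding T2 T'2 by algebra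
  finally have HD: "H * D = 16 * a * w * (a\<^sup>2 + 16 * w\<^sup>2)"
    unfolding mult_cancel_left by simp
  \<comment> \<open>Modulo 16, \<open>D\<close> is \<open>a ^ 6\<close>, and \<open>a ^ 4\<close> is
    1 because \<open>a = 1 + 4 * b\<close>. \<open>z\<close> is the exact quotient by 16: the term
    with \<open>b\<close> comes from \<open>a\<^sup>2 - a ^ 6\<close>, and those with factors 3, 48
    and 256 from expanding the cube.\<close>
  define z where "z = w\<^sup>2 - a\<^sup>2 * (b + 2 * b\<^sup>2) * (1 + 4 * b + 8 * b\<^sup>2) + 3 * a ^ 4 * w\<^sup>2
    - 48 * a\<^sup>2 * w ^ 4 + 256 * w ^ 6"
  have "a\<^sup>2 + 16 * w\<^sup>2 - D = 16 * z"
    using a_def unfolding D z_def by algebra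
  hence "(H - 16 * a * w) * D = 256 * (a * w * z)"
    using HD by algebra
  \<comment> \<open>\<open>I\<close> is the inverse of \<open>D\<close>: the generating function
    itself inverts \<open>T' ^ 3 * T\<close>.\<close>
  moreover define I where "I = (overcubic_pair_gf * T'\<^sup>2) ^ 6"
  have "D * I = (overcubic_pair_gf * (T' ^ 3 * T)) ^ 6"
    unfolding D_def I_def by algebra
  hence "D * I = 1"
    unfolding T_def T'_def overcubic_pair_gf_mult_theta by simp
  ultimately have "H - 16 * a * w = 256 * (a * w * z * I)"
    by algebra
  moreover have "T ^ 4 - T' ^ 4 = 16 * a * w"
  proof -
    have "T ^ 4 - T' ^ 4 = (T\<^sup>2)\<^sup>2 - (T'\<^sup>2)\<^sup>2" by simp
    thus ?thesis unfolding T2 T'2 by (simp add: power2_eq_square algebra_simps)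
  qed
  ultimately show ?thesis
    unfolding H_def G_def T_def T'_def by simp
qed

lemma overcubic_pairs_double_cong_theta_power4:
  assumes "odd m"
  shows "[overcubic_pairs (2 * m) = 2 * fps_nth (theta ^ 4) m] (mod 256)"
proof -
  obtain c where "fps_odd_part (fps_even_coeffs overcubic_pair_gf) - (theta ^ 4 - fps_neg_arg theta ^ 4) = 256 * c"
    using odd_part_even_coeffs_cong_theta_power4 by (rule dvdE)
  moreover have "theta ^ 4 - fps_neg_arg theta ^ 4 = 2 * fps_odd_part (theta ^ 4)"
    unfolding fps_neg_arg_power [symmetric] by (rule diff_fps_neg_arg)
  ultimately have "fps_nth (fps_odd_part (fps_even_coeffs overcubic_pair_gf) - 2 * fps_odd_part (theta ^ 4)) m
      = fps_nth (256 * c) m"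
    by simp
  hence "overcubic_pairs (2 * m) - 2 * fps_nth (theta ^ 4) m = 256 * fps_nth c m"
    using assms by (simp add: fps_odd_part_def fps_even_coeffs_def overcubic_pairs_def numeral_fps_const)
  thus ?thesis
    by (simp add: cong_iff_dvd_diff)
qed

subsection \<open>Sums of four squares\<close>

definition fps_supported_mod :: "nat \<Rightarrow> nat \<Rightarrow> 'a :: zero fps \<Rightarrow> bool" where
  "fps_supported_mod k r f \<longleftrightarrow> (\<forall>n. fps_nth f n \<noteq> 0 \<longrightarrow> [n = r] (mod k))"

lemma fps_supported_mod_mult:
  fixes f g :: "'a :: semiring_0 fps"
  assumes f: "fps_supported_mod k r f" and g: "fps_supported_mod k s g"
  shows "fps_supported_mod k (r + s) (f * g)"
  unfolding fps_supported_mod_def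
proof (intro allI impI)
  fix n assume "fps_nth (f * g) n \<noteq> 0"
  then obtain i where i: "i \<le> n" "fps_nth f i * fps_nth g (n - i) \<noteq> 0"
    unfolding fps_mult_nth by (rule sum.not_neutral_contains_not_neutral) auto
  hence "fps_nth f i \<noteq> 0" "fps_nth g (n - i) \<noteq> 0"
    by auto
  hence "[i + (n - i) = r + s] (mod k)"
    using f g unfolding fps_supported_mod_def by (intro cong_add) blast+
  thus "[n = r + s] (mod k)" using i(1) by simp
qed

text \<open>Exponents are 0 modulo 4 in \<open>e\<close> and 1 modulo 4 in \<open>v\<close>. In the
  expansion of \<open>(e + 2 * v) ^ 4\<close> only the product of one \<open>e\<close> and three
  \<open>v\<close> reaches residue 3, with coefficient 4 * 8 = 32.\<close>

lemma theta_power4_nth_dvd_32: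
  assumes "m mod 4 = 3"
  shows "32 dvd fps_nth (theta ^ 4) m"
proof -
  define e v where "e = theta_even" and "v = theta_half_odd"
  have e: "fps_supported_mod 4 0 e"
    by (auto simp: fps_supported_mod_def cong_def e_def theta_even_def theta_nth square_nat_mod_4
        split: if_splits)
  have v: "fps_supported_mod 4 1 v"
    by (auto simp: fps_supported_mod_def cong_def v_def theta_half_odd_def square_nat_mod_4
        split: if_splits)
  note mult = fps_supported_mod_mult
  have zero: "fps_nth f m = 0" if "fps_supported_mod 4 r f" "r mod 4 \<noteq> 3" for r and f :: "int fps"
    using that assms by (auto simp: fps_supported_mod_def cong_def)
  have z: "fps_nth (e * e * (e * e)) m = 0" "fps_nth (e * e * (e * v)) m = 0"
      "fps_nth (e * e * (v * v)) m = 0" "fps_nth (v * v * (v * v)) m = 0"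
    by (rule zero [OF mult [OF mult [OF e e] mult [OF e e]]]
             zero [OF mult [OF mult [OF e e] mult [OF e v]]]
             zero [OF mult [OF mult [OF e e] mult [OF v v]]]
             zero [OF mult [OF mult [OF v v] mult [OF v v]]]; simp)+
  have "theta ^ 4 = (e + 2 * v) ^ 4"
    by (simp add: e_def v_def theta_split(1))
  also have "\<dots> = e * e * (e * e) + 8 * (e * e * (e * v)) + 24 * (e * e * (v * v))
      + 32 * (e * v * (v * v)) + 16 * (v * v * (v * v))"
    by algebra
  finally have "fps_nth (theta ^ 4) m = 32 * fps_nth (e * v * (v * v)) m"
    by (simp add: numeral_fps_const z)
  thus ?thesis by simp
qed

definition four_square_reps :: "int \<Rightarrow> (int \<times> int \<times> int \<times> int) set" where
  "four_square_reps n = {(a, b, c, d). a\<^sup>2 + b\<^sup>2 + c\<^sup>2 + d\<^sup>2 = n}"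

lemma
  shows finite_four_square_reps: "finite (four_square_reps (int n))"
    and theta_power4_nth: "fps_nth (theta ^ 4) n = int (card (four_square_reps (int n)))"
proof -
  let ?e = "\<lambda>k::int. nat (k\<^sup>2)"
  note fin = finite_square_fibre
  note fin2 = finite_fibres_add [OF fin fin] and fin3 = finite_fibres_add [OF fin finite_fibres_add [OF fin fin]]
  have eq: "four_square_reps (int n) =
      {z. ?e (fst z) + (?e (fst (snd z)) + (?e (fst (snd (snd z))) + ?e (snd (snd (snd z))))) = n}"
  proof -
    have "nat (a\<^sup>2) + (nat (b\<^sup>2) + (nat (c\<^sup>2) + nat (d\<^sup>2))) = n \<longleftrightarrow> a\<^sup>2 + b\<^sup>2 + c\<^sup>2 + d\<^sup>2 = int n" for a b c d :: int
      by (simp add: nat_eq_iff add.assoc flip: nat_add_distrib)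
    thus ?thesis by (auto simp: four_square_reps_def)
  qed
  show "finite (four_square_reps (int n))"
    unfolding eq by (rule finite_fibres_add [OF fin fin3])
  have "theta ^ 4 = theta * (theta * (theta * theta))"
    by (simp add: eval_nat_numeral mult.assoc)
  also have "\<dots> = count_fps (\<lambda>z. ?e (fst z) + (?e (fst (snd z)) + (?e (fst (snd (snd z))) + ?e (snd (snd (snd z))))))"
    unfolding theta_def count_fps_mult [OF fin fin] count_fps_mult [OF fin fin2] count_fps_mult [OF fin fin3] ..
  finally show "fps_nth (theta ^ 4) n = int (card (four_square_reps (int n)))"
    unfolding eq by simp
qed

text \<open>
  The integer matrix \<open>?f\<close> below satisfies $A^T A = 3$, so it maps representations of $n$ to
  representations of $3n$; its image is cut out by membership modulo 3 in the tetracode, a totally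
  isotropic plane in $\mathbb{F}_3^4$. The even sign changes move this plane to four planes in which
  every nonzero isotropic vector lies exactly once.
\<close>

definition tetracode :: "int \<times> int \<times> int \<times> int \<Rightarrow> bool" where
  "tetracode = (\<lambda>(a, b, c, d). 3 dvd b + c + d \<and> 3 dvd a - c + d)"

lemma card_tetracode_reps:
  "card {w \<in> four_square_reps (3 * n). tetracode w} = card (four_square_reps n)"
proof (rule sym, rule bij_betw_same_card)
  let ?f = "\<lambda>(x, y, z, t). (y + z + t, z - x - t, t - x - y, y - x - z) :: int \<times> int \<times> int \<times> int"
  show "bij_betw ?f (four_square_reps n) {w \<in> four_square_reps (3 * n). tetracode w}"
  proof (rule bij_betw_imageI)
    show "inj_on ?f (four_square_reps n)"
      by (auto simp: inj_on_def)
    show "?f ` four_square_reps n = {w \<in> four_square_reps (3 * n). tetracode w}"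
    proof (rule equalityI [OF _ subsetI])
      show "?f ` four_square_reps n \<subseteq> {w \<in> four_square_reps (3 * n). tetracode w}"
      proof clarify
        fix x y z t assume "(x, y, z, t) \<in> four_square_reps n"
        hence "(y + z + t, z - x - t, t - x - y, y - x - z) \<in> four_square_reps (3 * n)"
          by (auto simp: four_square_reps_def power2_eq_square algebra_simps)
        moreover have "(z - x - t) + (t - x - y) + (y - x - z) = 3 * (- x)"
          "(y + z + t) - (t - x - y) + (y - x - z) = 3 * y"
          by simp_all
        hence "tetracode (y + z + t, z - x - t, t - x - y, y - x - z)"
          unfolding tetracode_def by (metis (no_types, lifting) case_prod_conv dvd_triv_left)
        ultimately show "(y + z + t, z - x - t, t - x - y, y - x - z) \<in> four_square_reps (3 * n)
            \<and> tetracode (y + z + t, z - x - t, t - x - y, y - x - z)" ..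
      qed
    next
      fix w assume w: "w \<in> {w \<in> four_square_reps (3 * n). tetracode w}"
      obtain a b c d where abcd: "w = (a, b, c, d)" by (cases w) auto
      obtain k l where "b + c + d = 3 * k" "a - c + d = 3 * l"
        using w abcd by (auto simp: tetracode_def elim!: dvdE)
      hence b: "b = 3 * k - c - d" and a: "a = 3 * l + c - d" by simp_all
      have "w = ?f (- k, l, l + k - d, l - k + c)"
        unfolding abcd a b by simp
      moreover have "(- k, l, l + k - d, l - k + c) \<in> four_square_reps n"
        using w unfolding abcd a b by (auto simp: four_square_reps_def power2_eq_square algebra_simps)
      ultimately show "w \<in> ?f ` four_square_reps n" by (rule image_eqI)
    qed
  qed
qed

text \<open>For \<open>s\<close> and \<open>t\<close> equal to 1 or -1 the four signs multiply to 1.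
  These are the even sign changes modulo global negation, which preserves the tetracode.\<close>

fun flip_signs :: "int \<Rightarrow> int \<Rightarrow> int \<times> int \<times> int \<times> int \<Rightarrow> int \<times> int \<times> int \<times> int" where
  "flip_signs s t (a, b, c, d) = (a, s * b, t * c, s * t * d)"

text \<open>Each sign change is an involution that keeps the sum of squares, so each of the four
  planes contains equally many representations.\<close>

lemma card_flip_signs_tetracode_reps:
  assumes "s \<in> {1, -1}" "t \<in> {1, -1}"
  shows "card {w \<in> four_square_reps (3 * n). tetracode (flip_signs s t w)} = card (four_square_reps n)"
proof -
  have "bij_betw (flip_signs s t) {w \<in> four_square_reps (3 * n). tetracode (flip_signs s t w)}
      {w \<in> four_square_reps (3 * n). tetracode w}"
    using assms
    by (intro bij_betw_byWitness [of _ "flip_signs s t"])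
       (auto simp: four_square_reps_def power_mult_distrib)
  thus ?thesis
    unfolding card_tetracode_reps [symmetric] by (rule bij_betw_same_card)
qed

lemma tetracode_flip_signs_mod:
  "tetracode (flip_signs s t (a mod 3, b mod 3, c mod 3, d mod 3)) \<longleftrightarrow>
   tetracode (flip_signs s t (a, b, c, d))"
proof -
  have "[s * (b mod 3) + t * (c mod 3) + s * t * (d mod 3) = s * b + t * c + s * t * d] (mod 3)"
    by (intro cong_add cong_mult cong_refl) simp_all
  moreover have "[a mod 3 - t * (c mod 3) + s * t * (d mod 3) = a - t * c + s * t * d] (mod 3)"
    by (intro cong_add cong_diff cong_mult cong_refl) simp_all
  ultimately show ?thesis
    by (simp add: tetracode_def cong_dvd_iff)
qed

text \<open>A finite check over residues: the 32 nonzero isotropic vectors have exactly three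
  nonzero entries, and four planes with 8 nonzero vectors each partition them. The sum of indicators
  states uniqueness in a form ready for double counting.\<close>

lemma tetracode_flip_signs_residues:
  "\<forall>a\<in>{0, 1, 2}. \<forall>b\<in>{0, 1, 2}. \<forall>c\<in>{0, 1, 2}. \<forall>d\<in>{0, 1, 2}. (a, b, c, d) \<noteq> (0, 0, 0, 0) \<longrightarrow>
     3 dvd a\<^sup>2 + b\<^sup>2 + c\<^sup>2 + d\<^sup>2 \<longrightarrow>
     of_bool (tetracode (flip_signs 1 1 (a, b, c, d))) + of_bool (tetracode (flip_signs 1 (-1) (a, b, c, d)))
     + of_bool (tetracode (flip_signs (-1) 1 (a, b, c, d)))
     + of_bool (tetracode (flip_signs (-1) (-1) (a, b, c, d))) = (1 :: nat)"
  by (simp add: tetracode_def)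

lemma ex1_tetracode_flip_signs:
  assumes "\<not> 3 dvd n" "w \<in> four_square_reps (3 * n)"
  shows "of_bool (tetracode (flip_signs 1 1 w)) + of_bool (tetracode (flip_signs 1 (-1) w))
     + of_bool (tetracode (flip_signs (-1) 1 w)) + of_bool (tetracode (flip_signs (-1) (-1) w)) = (1 :: nat)"
proof -
  obtain a b c d where w: "w = (a, b, c, d)" by (cases w) auto
  have eq: "a\<^sup>2 + b\<^sup>2 + c\<^sup>2 + d\<^sup>2 = 3 * n"
    using assms by (simp add: w four_square_reps_def)
  \<comment> \<open>If 3 divided all four entries, 9 would divide \<open>3 * n\<close>, against the
    hypothesis on \<open>n\<close>.\<close>
  have "(a mod 3, b mod 3, c mod 3, d mod 3) \<noteq> (0, 0, 0, 0)"
  proof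
    assume "(a mod 3, b mod 3, c mod 3, d mod 3) = (0, 0, 0, 0)"
    then obtain a' b' c' d' where "a = 3 * a'" "b = 3 * b'" "c = 3 * c'" "d = 3 * d'"
      by (auto simp: mod_eq_0_iff_dvd elim!: dvdE)
    hence "n = 3 * (a'\<^sup>2 + b'\<^sup>2 + c'\<^sup>2 + d'\<^sup>2)"
      using eq by (simp add: power_mult_distrib)
    thus False using assms(1) by simp
  qed
  moreover have "3 dvd (a mod 3)\<^sup>2 + (b mod 3)\<^sup>2 + (c mod 3)\<^sup>2 + (d mod 3)\<^sup>2"
  proof -
    have "[(a mod 3)\<^sup>2 + (b mod 3)\<^sup>2 + (c mod 3)\<^sup>2 + (d mod 3)\<^sup>2 = a\<^sup>2 + b\<^sup>2 + c\<^sup>2 + d\<^sup>2] (mod 3)"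
      by (intro cong_add cong_pow) simp_all
    thus ?thesis unfolding eq by (simp add: cong_dvd_iff)
  qed
  moreover have "x mod 3 \<in> {0, 1, 2}" for x :: int
    by auto
  ultimately have "of_bool (tetracode (flip_signs 1 1 (a mod 3, b mod 3, c mod 3, d mod 3)))
     + of_bool (tetracode (flip_signs 1 (-1) (a mod 3, b mod 3, c mod 3, d mod 3)))
     + of_bool (tetracode (flip_signs (-1) 1 (a mod 3, b mod 3, c mod 3, d mod 3)))
     + of_bool (tetracode (flip_signs (-1) (-1) (a mod 3, b mod 3, c mod 3, d mod 3))) = (1 :: nat)"
    by (intro tetracode_flip_signs_residues [rule_format])
  thus ?thesis unfolding tetracode_flip_signs_mod w .
qed

text \<open>Double counting: every representation of \<open>3 * n\<close> lies in exactly one of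
  four planes, and each plane accounts for as many as \<open>n\<close> has representations.\<close>

lemma card_four_square_reps_triple:
  assumes "\<not> 3 dvd n"
  shows "card (four_square_reps (3 * int n)) = 4 * card (four_square_reps (int n))"
proof -
  let ?W = "four_square_reps (3 * int n)"
  have fin: "finite ?W"
    using finite_four_square_reps [of "3 * n"] by simp
  have "\<not> 3 dvd int n"
    using assms by presburger
  hence "card ?W = (\<Sum>w\<in>?W. of_bool (tetracode (flip_signs 1 1 w)) + of_bool (tetracode (flip_signs 1 (-1) w))
     + of_bool (tetracode (flip_signs (-1) 1 w)) + of_bool (tetracode (flip_signs (-1) (-1) w)))"
    unfolding card_eq_sum by (intro sum.cong refl) (simp only: ex1_tetracode_flip_signs)
  also have "\<dots> = card {w \<in> ?W. tetracode (flip_signs 1 1 w)} + card {w \<in> ?W. tetracode (flip_signs 1 (-1) w)}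
    + card {w \<in> ?W. tetracode (flip_signs (-1) 1 w)} + card {w \<in> ?W. tetracode (flip_signs (-1) (-1) w)}"
    using fin by (simp add: sum.distrib Collect_conj_eq)
  also have "\<dots> = 4 * card (four_square_reps (int n))"
    by (simp add: card_flip_signs_tetracode_reps)
  finally show ?thesis .
qed

theorem theorem1p2:
  fixes n t :: nat
  assumes "t \<in> {42, 66}"
  shows "[overcubic_pairs (72 * n + t) = 0] (mod 256)"
proof -
  \<comment> \<open>\<open>t div 6\<close> is 7 or 11; both are 3 modulo 4 and prime to 3, while
    \<open>12 * n\<close> vanishes modulo 4 and 3.\<close>
  define l where "l = 12 * n + t div 6"
  have l: "72 * n + t = 2 * (3 * l)" "l mod 4 = 3" "\<not> 3 dvd l"
    using assms unfolding l_def by (auto, presburger+)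
  have "odd (3 * l)"
    using l(2) by presburger
  hence "[overcubic_pairs (72 * n + t) = 2 * fps_nth (theta ^ 4) (3 * l)] (mod 256)"
    unfolding l(1) by (rule overcubic_pairs_double_cong_theta_power4)
  moreover have "fps_nth (theta ^ 4) (3 * l) = 4 * fps_nth (theta ^ 4) l"
    using card_four_square_reps_triple [OF l(3)] by (simp add: theta_power4_nth)
  moreover obtain k where "fps_nth (theta ^ 4) l = 32 * k"
    using theta_power4_nth_dvd_32 [OF l(2)] by (rule dvdE)
  \<comment> \<open>The factors 2, 4 and 32 multiply to 256.\<close>
  ultimately show ?thesis
    by (simp add: cong_def)
qed

end
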